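(* In general, Henstock integrability of $g$ does not imply Henstock integrability of the multifunction determined by $g$: there exist a Banach space $X$ and a Henstock integrable function $g:[0,1]\to X$ such that the multifunction $G:[0,1]\to ck(X)$, $G(t)=\mathrm{conv}\{0,g(t)\}$, is not Henstock integrable.
   Context: $ck(X)$ is the family of all nonempty convex compact subsets of $X$, with the Hausdorff metric $d_H$ and Minkowski addition; $|I|$ is the length of an interval $I$. A Perron partition of $[0,1]$ is a finite collection of pairs $\{(I_1,t_1),\dots,(I_p,t_p)\}$ where $I_1,\dots,I_p$ are nonoverlapping closed subintervals of $[0,1]$ with union $[0,1]$ and $t_i\in I_i$ for all $i$. A gauge is a function $\delta:[0,1]\to(0,\infty)$; a partition is $\delta$-fine if $I_i\subset(t_i-\delta(t_i),t_i+\delta(t_i))$ for all $i$. A multifunction $G:[0,1]\to ck(X)$ is Henstock integrable if there exists $\Phi\in ck(X)$ such that for every $\varepsilon>0$ there is a gauge $\delta$ with $d_H(\Phi,\sum_{i=1}^p G(t_i)|I_i|)<\varepsilon$ for each $\delta$-fine Perron partition $\{(I_i,t_i)\}_{i=1}^p$ of $[0,1]$. Henstock integrability of a function $g:[0,1]\to X$ is defined in the same way, with $\Phi\in X$ and $d_H$ replaced by the norm distance. *)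

theory Defs
  imports "HOL-Analysis.Analysis" "HOL-Analysis.Finite_Function_Topology"
begin

text \<open>
  Banach spaces as linear subspaces \<open>X\<close> of an ambient real vector space, equipped with a complete norm
  \<open>nrm\<close> of their own, so that one can quantify existentially over the space. No norm or topology that
  the ambient type may carry plays any role.
\<close>

locale normed_space_on =
  fixes X :: "'v::real_vector set" and nrm :: "'v \<Rightarrow> real"
  assumes subspace_carrier: "subspace X"
    and nrm_nonneg: "x \<in> X \<Longrightarrow> 0 \<le> nrm x"
    and nrm_eq_0_iff: "x \<in> X \<Longrightarrow> nrm x = 0 \<longleftrightarrow> x = 0"
    and nrm_scaleR: "x \<in> X \<Longrightarrow> nrm (c *\<^sub>R x) = \<bar>c\<bar> * nrm x"
    and nrm_triangle: "x \<in> X \<Longrightarrow> y \<in> X \<Longrightarrow> nrm (x + y) \<le> nrm x + nrm y"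
begin

text \<open>The value off \<open>X\<close> is irrelevant; \<open>Metric_space\<close> wants it symmetric and nonnegative there too.\<close>

definition ndist :: "'v \<Rightarrow> 'v \<Rightarrow> real"
  where "ndist x y = (if x \<in> X \<and> y \<in> X then nrm (x - y) else 0)"

end

sublocale normed_space_on \<subseteq> Metric_space X ndist
proof
  show "0 \<le> ndist x y" for x y
    by (simp add: ndist_def nrm_nonneg subspace_carrier subspace_diff)
  show "ndist x y = ndist y x" for x y
  proof (cases "x \<in> X \<and> y \<in> X")
    case True
    then have "nrm ((- 1) *\<^sub>R (x - y)) = nrm (x - y)"
      using nrm_scaleR[of "x - y" "- 1"] by (simp add: subspace_carrier subspace_diff)
    then show ?thesis
      by (simp add: ndist_def)
  qed (auto simp: ndist_def)
  show "ndist x y = 0 \<longleftrightarrow> x = y" if "x \<in> X" "y \<in> X" for x y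
    using that by (simp add: ndist_def nrm_eq_0_iff subspace_carrier subspace_diff)
  show "ndist x z \<le> ndist x y + ndist y z" if "x \<in> X" "y \<in> X" "z \<in> X" for x y z
    using that nrm_triangle[of "x - y" "y - z"]
    by (simp add: ndist_def subspace_carrier subspace_diff)
qed

locale banach_space_on = normed_space_on +
  assumes complete: mcomplete
begin

definition ck :: "'a set set"
  where "ck = {A. A \<noteq> {} \<and> convex A \<and> compactin mtopology A}"

definition hausdorff_dist :: "'a set \<Rightarrow> 'a set \<Rightarrow> real"
  where "hausdorff_dist A B =
    max (SUP a\<in>A. INF b\<in>B. ndist a b) (SUP b\<in>B. INF a\<in>A. ndist a b)"

definition henstock_integrable :: "(real \<Rightarrow> 'a) \<Rightarrow> bool"
  where "henstock_integrable g \<longleftrightarrow>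
    (\<exists>\<Phi>\<in>X. \<forall>\<epsilon>>0. \<exists>\<delta> :: real \<Rightarrow> real. (\<forall>t\<in>{0..1}. 0 < \<delta> t) \<and>
      (\<forall>p. p tagged_division_of {0..1} \<and> (\<lambda>t. {t - \<delta> t <..< t + \<delta> t}) fine p \<longrightarrow>
        ndist \<Phi> (\<Sum>(t, I)\<in>p. measure lborel I *\<^sub>R g t) < \<epsilon>))"

text \<open>The sum in the next definition is the Minkowski sum of \<open>HOL-Library.Set_Algebras\<close>.\<close>

definition henstock_integrable_multi :: "(real \<Rightarrow> 'a set) \<Rightarrow> bool"
  where "henstock_integrable_multi G \<longleftrightarrow>
    (\<exists>\<Phi>\<in>ck. \<forall>\<epsilon>>0. \<exists>\<delta> :: real \<Rightarrow> real. (\<forall>t\<in>{0..1}. 0 < \<delta> t) \<and>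
      (\<forall>p. p tagged_division_of {0..1} \<and> (\<lambda>t. {t - \<delta> t <..< t + \<delta> t}) fine p \<longrightarrow>
        hausdorff_dist \<Phi> (\<Sum>(t, I)\<in>p. (*\<^sub>R) (measure lborel I) ` G t) < \<epsilon>))"

end

end

theory Submission
  imports Defs
begin

text \<open>
  Already the real line is a counterexample. A Riemann sum of \<open>conv {0, g t}\<close> contains the Riemann
  sums of both the positive and the negative part of \<open>g\<close>, so Henstock integrability of the
  multifunction bounds the Riemann sums of \<open>\<bar>g\<bar>\<close> over all sufficiently fine partitions. This fails for
  \<open>g = F'\<close> with \<open>F x = x cos (\<pi> / x)\<close>, \<open>F 0 = 0\<close>: \<open>F\<close> is continuous and differentiable off \<open>0\<close>, so \<open>g\<close> is
  Henstock integrable, but \<open>F (1 / n) = (-1)\<^sup>n / n\<close> has infinite variation.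
\<close>

section \<open>Riemann sums of absolute values\<close>

text \<open>The two partitions may share a pair, but such a pair has its interval inside
  \<open>{b}\<close>, hence of measure zero. So nothing is lost when \<open>p \<union> q\<close>
  counts it once.\<close>

lemma abs_riemann_sum_Un:
  fixes f :: "real \<Rightarrow> real"
  assumes p: "p tagged_division_of {a..b}" and q: "q tagged_division_of {b..c}"
    and ab: "a \<le> b" and bc: "b \<le> c"
  shows "p \<union> q tagged_division_of {a..c}"
    and "(\<Sum>(t, I)\<in>p \<union> q. measure lborel I * \<bar>f t\<bar>) =
      (\<Sum>(t, I)\<in>p. measure lborel I * \<bar>f t\<bar>) + (\<Sum>(t, I)\<in>q. measure lborel I * \<bar>f t\<bar>)"
proof -
  have "interior {a..b} \<inter> interior {b..c} = {}"
    by auto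
  then show "p \<union> q tagged_division_of {a..c}"
    using tagged_division_Un[OF p q] ivl_disj_un_two_touch(4)[OF ab bc] by simp
  have "measure lborel I = 0" if tI: "(t, I) \<in> p" "(t, I) \<in> q" for t I
  proof -
    have "I \<subseteq> {b}"
      using tagged_division_ofD(3)[OF p tI(1)] tagged_division_ofD(3)[OF q tI(2)] by fastforce
    moreover obtain u v where "I = cbox u v"
      using tagged_division_ofD(4)[OF p tI(1)] by blast
    moreover have "interior I = {}"
      using interior_mono[OF \<open>I \<subseteq> {b}\<close>] by simp
    ultimately show ?thesis
      by (simp only: content_eq_0_interior)
  qed
  then show "(\<Sum>(t, I)\<in>p \<union> q. measure lborel I * \<bar>f t\<bar>) =
      (\<Sum>(t, I)\<in>p. measure lborel I * \<bar>f t\<bar>) + (\<Sum>(t, I)\<in>q. measure lborel I * \<bar>f t\<bar>)"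
    using p q by (intro sum.union_inter_neutral) auto
qed

lemma abs_riemann_sum_nonneg: "0 \<le> (\<Sum>(t, I)\<in>p. measure lborel I * \<bar>f t :: real\<bar>)"
  by (intro sum_nonneg) auto

text \<open>The integral bounds these sums from below: on a partition that is also fine for a gauge
  with tolerance \<open>\<bar>y\<bar> - c\<close>, the signed Riemann sum already exceeds
  \<open>c\<close> in modulus, and the triangle inequality passes to
  \<open>\<bar>f\<bar>\<close>.\<close>

lemma abs_riemann_sum_gt:
  fixes f :: "real \<Rightarrow> real"
  assumes f: "(f has_integral y) {a..b}" and c: "c < \<bar>y\<bar>" and "gauge \<gamma>"
  obtains p where "p tagged_division_of {a..b}" "\<gamma> fine p" "c < (\<Sum>(t, I)\<in>p. measure lborel I * \<bar>f t\<bar>)"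
proof -
  from c f obtain \<gamma>' where \<gamma>': "gauge \<gamma>'" and
    close: "\<And>p. p tagged_division_of {a..b} \<Longrightarrow> \<gamma>' fine p \<Longrightarrow>
      norm ((\<Sum>(t, I)\<in>p. measure lborel I *\<^sub>R f t) - y) < \<bar>y\<bar> - c"
    unfolding has_integral_real by (metis diff_gt_0_iff_gt)
  from \<open>gauge \<gamma>\<close> \<gamma>' have "gauge (\<lambda>x. \<gamma> x \<inter> \<gamma>' x)"
    by (rule gauge_Int)
  then obtain p where p: "p tagged_division_of {a..b}" "(\<lambda>x. \<gamma> x \<inter> \<gamma>' x) fine p"
    by (rule fine_division_exists_real)
  then have "\<gamma> fine p" "\<gamma>' fine p"
    by (auto simp: fine_Int)
  have "c < \<bar>\<Sum>(t, I)\<in>p. measure lborel I *\<^sub>R f t\<bar>"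
    using close[OF p(1) \<open>\<gamma>' fine p\<close>] by simp
  also have "\<dots> \<le> (\<Sum>(t, I)\<in>p. measure lborel I * \<bar>f t\<bar>)"
    by (rule order_trans[OF sum_abs]) (auto simp: abs_mult intro!: sum_mono)
  finally show thesis
    using that p(1) \<open>\<gamma> fine p\<close> by blast
qed

section \<open>A Henstock integrable function that is not absolutely integrable\<close>

definition osc :: "real \<Rightarrow> real"
  where "osc x = x * cos (pi / x)"

text \<open>The derivative of \<open>osc\<close> away from 0. At 0 the convention
  \<open>pi / 0 = 0\<close> gives the value 1, which is not a derivative there.\<close>

definition osc_deriv :: "real \<Rightarrow> real"
  where "osc_deriv x = cos (pi / x) + pi / x * sin (pi / x)"

lemma continuous_on_osc: "continuous_on A osc"
proof -
  have "isCont osc x" for x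
  proof (cases "x = 0")
    case True
    have "((\<lambda>x. x * cos (pi / x)) \<longlongrightarrow> 0) (at 0)"
      by (rule lim_null_mult_right_bounded[where B = 1]) auto
    then show ?thesis
      using True by (simp add: isCont_def osc_def[abs_def])
  next
    case False
    then show ?thesis
      unfolding osc_def[abs_def] by (intro continuous_intros) auto
  qed
  then show ?thesis
    by (simp add: continuous_at_imp_continuous_on)
qed

text \<open>The fundamental theorem of calculus tolerates the exceptional point 0, where
  \<open>osc\<close> is continuous but not differentiable.\<close>

lemma has_integral_osc_deriv:
  assumes "a \<le> b"
  shows "(osc_deriv has_integral osc b - osc a) {a..b}"
proof (rule fundamental_theorem_of_calculus_interior_strong[of "{0}"])
  fix x :: real
  assume "x \<in> {a<..<b} - {0}"
  then have "(osc has_real_derivative osc_deriv x) (at x)"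
    unfolding osc_def[abs_def] osc_deriv_def
    by (auto intro!: derivative_eq_intros simp: field_simps power2_eq_square)
  then show "(osc has_vector_derivative osc_deriv x) (at x)"
    by (simp add: has_real_derivative_iff_has_vector_derivative)
qed (use assms continuous_on_osc in auto)

lemma osc_inverse_Suc: "osc (1 / Suc n) = (- 1) ^ Suc n / Suc n"
  unfolding osc_def using cos_npi[of "Suc n"] by (simp add: mult.commute)

text \<open>Induction from right to left: the interval from \<open>1 / (n + 2)\<close> to
  \<open>1 / (n + 1)\<close> contributes more than the next harmonic term
  \<open>1 / (n + 1)\<close>.\<close>

lemma abs_riemann_sum_osc_deriv_ge_harm:
  assumes "gauge \<gamma>"
  shows "\<exists>p. p tagged_division_of {1 / Suc n..1} \<and> \<gamma> fine p \<and>
    harm n \<le> (\<Sum>(t, I)\<in>p. measure lborel I * \<bar>osc_deriv t\<bar>)"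
proof (induction n)
  case 0
  obtain p where "p tagged_division_of {1 / Suc 0..1}" "\<gamma> fine p"
    using fine_division_exists_real[OF assms] .
  moreover have "harm 0 \<le> (\<Sum>(t, I)\<in>p. measure lborel I * \<bar>osc_deriv t\<bar>)"
    using abs_riemann_sum_nonneg[of osc_deriv p] by (simp add: harm_def)
  ultimately show ?case
    by blast
next
  case (Suc n)
  then obtain p where p: "p tagged_division_of {1 / Suc n..1}" "\<gamma> fine p"
    "harm n \<le> (\<Sum>(t, I)\<in>p. measure lborel I * \<bar>osc_deriv t\<bar>)"
    by blast
  have le: "1 / real (Suc (Suc n)) \<le> 1 / Suc n"
    by (simp add: frac_le)
  \<comment> \<open>The values at the two endpoints have opposite signs, so their moduli add up. The
    surplus \<open>1 / (n + 2)\<close> gives the strict inequality that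
    \<open>abs_riemann_sum_gt\<close> asks for.\<close>
  have "\<bar>osc (1 / Suc n) - osc (1 / Suc (Suc n))\<bar> = 1 / Suc n + 1 / Suc (Suc n)"
  proof -
    have "osc (1 / Suc n) - osc (1 / Suc (Suc n)) =
        (- 1) ^ Suc n * (1 / Suc n + 1 / Suc (Suc n))"
      unfolding osc_inverse_Suc by (simp add: algebra_simps)
    then show ?thesis
      by (simp add: abs_mult power_abs)
  qed
  then have "1 / Suc n < \<bar>osc (1 / Suc n) - osc (1 / Suc (Suc n))\<bar>"
    by simp
  from abs_riemann_sum_gt[OF has_integral_osc_deriv[OF le] this assms]
  obtain q where q: "q tagged_division_of {1 / Suc (Suc n)..1 / Suc n}" "\<gamma> fine q"
    "1 / Suc n < (\<Sum>(t, I)\<in>q. measure lborel I * \<bar>osc_deriv t\<bar>)"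
    by blast
  have "1 / real (Suc n) \<le> 1"
    by simp
  note Un = abs_riemann_sum_Un[OF q(1) p(1) le this]
  have "harm (Suc n) = harm n + 1 / real (Suc n)"
    by (simp add: harm_Suc inverse_eq_divide)
  then have "harm (Suc n) \<le> (\<Sum>(t, I)\<in>q \<union> p. measure lborel I * \<bar>osc_deriv t\<bar>)"
    unfolding Un(2) using p(3) q(3) by linarith
  then show ?case
    using Un(1) fine_Un[OF q(2) p(2)] by blast
qed

text \<open>The harmonic series diverges. Any fine partition of the remaining interval next to 0
  completes the partition, since its terms are nonnegative.\<close>

lemma abs_riemann_sum_osc_deriv_unbounded:
  assumes "gauge \<gamma>"
  obtains p where "p tagged_division_of {0..1}" "\<gamma> fine p"
    "B < (\<Sum>(t, I)\<in>p. measure lborel I * \<bar>osc_deriv t\<bar>)"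
proof -
  obtain n where n: "B < harm n"
    using harm_at_top by (metis eventually_happens filterlim_at_top_dense trivial_limit_sequentially)
  obtain p where p: "p tagged_division_of {1 / Suc n..1}" "\<gamma> fine p"
    "harm n \<le> (\<Sum>(t, I)\<in>p. measure lborel I * \<bar>osc_deriv t\<bar>)"
    using abs_riemann_sum_osc_deriv_ge_harm[OF assms] by blast
  obtain q where q: "q tagged_division_of {0..1 / Suc n}" "\<gamma> fine q"
    using fine_division_exists_real[OF assms] .
  have "0 \<le> 1 / real (Suc n)" "1 / real (Suc n) \<le> 1"
    by simp_all
  note Un = abs_riemann_sum_Un[OF q(1) p(1) this]
  show thesis
  proof (rule that[OF Un(1) fine_Un[OF q(2) p(2)]])
    show "B < (\<Sum>(t, I)\<in>q \<union> p. measure lborel I * \<bar>osc_deriv t\<bar>)"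
      unfolding Un(2) using n p(3) abs_riemann_sum_nonneg[of osc_deriv q] by linarith
  qed
qed

section \<open>The real line inside the finitely supported functions\<close>

definition emb :: "real \<Rightarrow> (real \<Rightarrow>\<^sub>0 real)"
  where "emb c = Poly_Mapping.single 0 c"

text \<open>Only a seminorm on the whole type, but a norm on \<open>range emb\<close>, for which
  \<open>emb\<close> is a linear isometry from the reals.\<close>

definition nrm0 :: "(real \<Rightarrow>\<^sub>0 real) \<Rightarrow> real"
  where "nrm0 x = \<bar>Poly_Mapping.lookup x 0\<bar>"

lemma lookup_scaleR: "Poly_Mapping.lookup (c *\<^sub>R x) i = c *\<^sub>R Poly_Mapping.lookup x i"
  for x :: "'a \<Rightarrow>\<^sub>0 'b::real_vector"
proof -
  have "finite {i. c *\<^sub>R Poly_Mapping.lookup x i \<noteq> 0}"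
    by (rule finite_subset[OF _ finite_lookup[of x]]) auto
  then show ?thesis
    by (simp add: scaleR_poly_mapping_def lookup_Abs_poly_mapping)
qed

lemma lookup_emb [simp]: "Poly_Mapping.lookup (emb c) 0 = c"
  by (simp add: emb_def)

lemma emb_zero [simp]: "emb 0 = 0"
  by (simp add: emb_def)

lemma emb_add: "emb (a + b) = emb a + emb b"
  by (simp add: emb_def single_add)

lemma emb_diff: "emb (a - b) = emb a - emb b"
  by (simp add: emb_def single_diff)

lemma emb_scaleR: "emb (c * a) = c *\<^sub>R emb a"
  by (rule poly_mapping_eqI) (simp add: emb_def lookup_scaleR lookup_single when_def)

lemma emb_sum: "emb (sum f A) = (\<Sum>x\<in>A. emb (f x))"
  by (induction A rule: infinite_finite_induct) (simp_all add: emb_add)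

lemma nrm0_emb [simp]: "nrm0 (emb c) = \<bar>c\<bar>"
  by (simp add: nrm0_def)

interpretation line: normed_space_on "range emb" nrm0
proof
  show "subspace (range emb)"
    unfolding subspace_def
    by (auto simp flip: emb_add emb_scaleR) (metis emb_zero rangeI)
  show "nrm0 x = 0 \<longleftrightarrow> x = 0" if "x \<in> range emb" for x
    using that by (auto simp: nrm0_def emb_def)
qed (auto simp: lookup_scaleR lookup_add nrm0_def abs_mult)

lemma ndist_emb [simp]: "line.ndist (emb a) (emb b) = \<bar>a - b\<bar>"
  by (simp add: line.ndist_def flip: emb_diff)

text \<open>Completeness is pulled back along the isometry \<open>emb\<close>: the coordinates at 0
  of a Cauchy sequence form a real Cauchy sequence.\<close>

interpretation line: banach_space_on "range emb" nrm0
proof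
  show "line.mcomplete"
    unfolding line.mcomplete_def
  proof (intro allI impI)
    fix \<sigma>
    assume Cauchy: "line.MCauchy \<sigma>"
    define s where "s n = Poly_Mapping.lookup (\<sigma> n) 0" for n
    have s: "\<sigma> n = emb (s n)" for n
    proof -
      have "\<sigma> n \<in> range emb"
        using Cauchy unfolding line.MCauchy_def by blast
      then show ?thesis
        by (auto simp: s_def)
    qed
    have "Cauchy s"
    proof (rule metric_CauchyI)
      fix e :: real
      assume "0 < e"
      then obtain N where "\<And>m n. N \<le> m \<Longrightarrow> N \<le> n \<Longrightarrow> line.ndist (\<sigma> m) (\<sigma> n) < e"
        using Cauchy unfolding line.MCauchy_def by metis
      then show "\<exists>N. \<forall>m\<ge>N. \<forall>n\<ge>N. dist (s m) (s n) < e"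
        unfolding s ndist_emb dist_real_def by blast
    qed
    then obtain l where "s \<longlonglongrightarrow> l"
      using Cauchy_convergent convergent_def by blast
    then have "limitin line.mtopology \<sigma> (emb l) sequentially"
      by (simp add: line.limit_metric_sequentially s lim_sequentially dist_real_def)
    then show "\<exists>x. limitin line.mtopology \<sigma> x sequentially"
      by blast
  qed
qed

lemma continuous_map_emb: "continuous_map euclideanreal line.mtopology emb"
  unfolding line.continuous_map_to_metric
proof (intro ballI allI impI)
  fix x r :: real
  assume "0 < r"
  then show "\<exists>U. openin euclideanreal U \<and> x \<in> U \<and> (\<forall>y\<in>U. emb y \<in> line.mball (emb x) r)"
    by (intro exI[of _ "ball x r"]) (auto simp: dist_real_def)
qed

lemma convex_hull_emb: "convex hull {0, emb a} = (\<lambda>u. emb (u * a)) ` {0..1}"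
  by (simp add: emb_scaleR closed_segment_def flip: segment_convex_hull) (auto simp: image_def)

text \<open>The segment is a continuous image of the compact interval \<open>[0,1]\<close>.\<close>

lemma convex_hull_emb_in_ck: "convex hull {0, emb a} \<in> line.ck"
proof -
  have "continuous_map euclideanreal line.mtopology (emb \<circ> (\<lambda>u. u * a))"
    by (intro continuous_map_compose[OF _ continuous_map_emb])
       (auto simp: continuous_map_iff_continuous2 intro!: continuous_intros)
  then have "compactin line.mtopology ((emb \<circ> (\<lambda>u. u * a)) ` {0..1})"
    by (intro image_compactin) auto
  then have "compactin line.mtopology (convex hull {0, emb a})"
    by (simp add: convex_hull_emb image_image o_def)
  then show ?thesis
    by (simp add: line.ck_def)
qed

section \<open>Henstock integrals and Minkowski sums on the embedded line\<close>

lemma henstock_integrable_emb: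
  assumes "(f has_integral y) {0..1}"
  shows "line.henstock_integrable (\<lambda>t. emb (f t))"
  unfolding line.henstock_integrable_def
proof (intro bexI[of _ "emb y"] allI impI)
  fix \<epsilon> :: real
  assume "0 < \<epsilon>"
  with assms obtain \<gamma> where "gauge \<gamma>" and
    \<gamma>: "\<And>p. p tagged_division_of {0..1} \<Longrightarrow> \<gamma> fine p \<Longrightarrow>
      norm ((\<Sum>(t, I)\<in>p. measure lborel I *\<^sub>R f t) - y) < \<epsilon>"
    unfolding has_integral_real by metis
  \<comment> \<open>A gauge of the library assigns open sets to points; choosing radii inside them
    turns it into a positive function.\<close>
  then have "\<forall>t. \<exists>d>0. ball t d \<subseteq> \<gamma> t"
    by (metis gauge_def openE)
  then obtain \<delta> where \<delta>: "\<And>t. 0 < \<delta> t" "\<And>t. ball t (\<delta> t) \<subseteq> \<gamma> t"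
    by metis
  have "line.ndist (emb y) (\<Sum>(t, I)\<in>p. measure lborel I *\<^sub>R emb (f t)) < \<epsilon>"
    if p: "p tagged_division_of {0..1}" "(\<lambda>t. {t - \<delta> t <..< t + \<delta> t}) fine p" for p
  proof -
    have "(\<Sum>(t, I)\<in>p. measure lborel I *\<^sub>R emb (f t)) = emb (\<Sum>(t, I)\<in>p. measure lborel I *\<^sub>R f t)"
      by (simp add: emb_sum emb_scaleR case_prod_beta)
    moreover have "\<gamma> fine p"
      using p(2) \<delta>(2) unfolding fine_def ball_eq_greaterThanLessThan by blast
    ultimately show ?thesis
      using \<gamma>[OF p(1)] by (simp add: abs_minus_commute)
  qed
  with \<delta>(1) show "\<exists>\<delta>. (\<forall>t\<in>{0..1}. 0 < \<delta> t) \<and>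
      (\<forall>p. p tagged_division_of {0..1} \<and> (\<lambda>t. {t - \<delta> t <..< t + \<delta> t}) fine p \<longrightarrow>
        line.ndist (emb y) (\<Sum>(t, I)\<in>p. measure lborel I *\<^sub>R emb (f t)) < \<epsilon>)"
    by blast
qed simp

text \<open>Every point of \<open>B\<close> is within \<open>e\<close> of some point of
  \<open>A\<close>. The bound \<open>C\<close> serves to make the supremum over \<open>B\<close> a
  genuine one and does not enter the estimate.\<close>

lemma hausdorff_dist_less_imp_bound:
  assumes less: "line.hausdorff_dist (emb ` A) (emb ` B) < e"
    and "A \<noteq> {}" and A: "\<And>a. a \<in> A \<Longrightarrow> \<bar>a\<bar> \<le> M" and B: "\<And>b. b \<in> B \<Longrightarrow> \<bar>b\<bar> \<le> C" and "b \<in> B"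
  shows "\<bar>b\<bar> < M + e"
proof -
  have bdd_below: "bdd_below ((\<lambda>a. \<bar>b - a\<bar>) ` A)" for b
    by (rule bdd_belowI[of _ 0]) auto
  obtain a where "a \<in> A"
    using \<open>A \<noteq> {}\<close> by blast
  have "(INF a\<in>A. \<bar>b - a\<bar>) \<le> C + M" if "b \<in> B" for b
    using cINF_lower[OF bdd_below \<open>a \<in> A\<close>, of b] A[OF \<open>a \<in> A\<close>] B[OF that] by linarith
  then have "bdd_above ((\<lambda>b. INF a\<in>A. \<bar>b - a\<bar>) ` B)"
    by (intro bdd_aboveI2)
  then have "(INF a\<in>A. \<bar>b - a\<bar>) \<le> (SUP b\<in>B. INF a\<in>A. \<bar>b - a\<bar>)"
    using \<open>b \<in> B\<close> by (rule cSUP_upper[rotated])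
  also have "\<dots> < e"
    using less by (simp add: line.hausdorff_dist_def image_image abs_minus_commute)
  finally obtain a' where "a' \<in> A" "\<bar>b - a'\<bar> < e"
    using \<open>A \<noteq> {}\<close> bdd_below by (auto simp: cINF_less_iff)
  then show ?thesis
    using A[of a'] by linarith
qed

text \<open>An element of a Minkowski sum is a sum of independent choices, here a factor in
  \<open>[0,1]\<close> for each segment. The weight \<open>u\<close> depends on the pair, not just
  on the tag, because one point can tag two adjacent intervals.\<close>

lemma minkowski_sum_convex_hull_emb:
  fixes p :: "('a \<times> 'b::euclidean_space set) set"
  assumes "finite p"
  shows "(\<Sum>(t, I)\<in>p. (*\<^sub>R) (measure lborel I) ` (convex hull {0, emb (f t)})) =
    emb ` {\<Sum>(t, I)\<in>p. measure lborel I * (u (t, I) * f t) | u. \<forall>x\<in>p. u x \<in> {0..1}}"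
    (is "?L = emb ` ?R")
proof
  show "?L \<subseteq> emb ` ?R"
  proof
    fix x
    assume "x \<in> ?L"
    then obtain s where x: "x = sum s p"
      and s: "\<forall>z\<in>p. s z \<in> (case z of (t, I) \<Rightarrow> (*\<^sub>R) (measure lborel I) ` (convex hull {0, emb (f t)}))"
      unfolding set_sum_alt[OF assms] by blast
    have "\<forall>z\<in>p. \<exists>u\<in>{0..1}. s z = emb (measure lborel (snd z) * (u * f (fst z)))"
      using s by (fastforce simp: convex_hull_emb emb_scaleR)
    then obtain u where u: "\<And>z. z \<in> p \<Longrightarrow> u z \<in> {0..1}"
      "\<And>z. z \<in> p \<Longrightarrow> s z = emb (measure lborel (snd z) * (u z * f (fst z)))"
      by metis
    then have "x = emb (\<Sum>(t, I)\<in>p. measure lborel I * (u (t, I) * f t))"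
      by (simp add: x emb_sum case_prod_beta)
    with u(1) show "x \<in> emb ` ?R"
      by blast
  qed
  show "emb ` ?R \<subseteq> ?L"
  proof clarify
    fix u :: "'a \<times> 'b set \<Rightarrow> real"
    assume u: "\<forall>x\<in>p. u x \<in> {0..1}"
    let ?s = "\<lambda>z. emb (measure lborel (snd z) * (u z * f (fst z)))"
    have "emb (\<Sum>(t, I)\<in>p. measure lborel I * (u (t, I) * f t)) = sum ?s p"
      by (simp add: emb_sum case_prod_beta)
    moreover have "?s z \<in> (case z of (t, I) \<Rightarrow> (*\<^sub>R) (measure lborel I) ` (convex hull {0, emb (f t)}))"
      if "z \<in> p" for z
      using u that by (auto simp: convex_hull_emb emb_scaleR[of "measure lborel _"] split: prod.split)
    ultimately show "emb (\<Sum>(t, I)\<in>p. measure lborel I * (u (t, I) * f t)) \<in> ?L"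
      unfolding set_sum_alt[OF assms] by blast
  qed
qed

text \<open>Tolerance 1 suffices: the Minkowski sums then stay within distance 1 of the compact,
  hence bounded, set \<open>\<Phi>\<close>, and they contain the sums of the positive and of the
  negative part of \<open>f\<close>.\<close>

lemma henstock_integrable_multi_imp_bounded:
  assumes "line.henstock_integrable_multi (\<lambda>t. convex hull {0, emb (f t)})"
  obtains \<gamma> B where "gauge \<gamma>" "\<And>p. p tagged_division_of {0..1} \<Longrightarrow> \<gamma> fine p \<Longrightarrow>
    (\<Sum>(t, I)\<in>p. measure lborel I * \<bar>f t\<bar>) \<le> B"
proof -
  let ?S = "\<lambda>p. \<Sum>(t, I)\<in>p. (*\<^sub>R) (measure lborel I) ` (convex hull {0, emb (f t)})"
  obtain \<Phi> \<delta> where "\<Phi> \<in> line.ck" and \<delta>: "\<forall>t\<in>{0..1}. 0 < \<delta> t" and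
    close: "\<And>p. p tagged_division_of {0..1} \<Longrightarrow> (\<lambda>t. {t - \<delta> t <..< t + \<delta> t}) fine p \<Longrightarrow>
      line.hausdorff_dist \<Phi> (?S p) < 1"
    using assms unfolding line.henstock_integrable_multi_def
    by (elim bexE allE[where x = "1 :: real"] impE exE conjE) (simp, blast)
  then have "line.mbounded \<Phi>" "\<Phi> \<noteq> {}"
    by (auto simp: line.ck_def line.compactin_imp_mbounded)
  then obtain z M0 where \<Phi>: "\<Phi> \<subseteq> range emb" "\<And>x. x \<in> \<Phi> \<Longrightarrow> line.ndist (emb z) x \<le> M0"
    by (fastforce simp: line.mbounded)
  then obtain A where A: "\<Phi> = emb ` A"
    by (auto simp: subset_image_iff)
  have "A \<noteq> {}"
    using A \<open>\<Phi> \<noteq> {}\<close> by blast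
  \<comment> \<open>Recenters the bounding ball of \<open>\<Phi>\<close> from \<open>z\<close> to
    0.\<close>
  define M where "M = M0 + \<bar>z\<bar>"
  have M: "\<bar>a\<bar> \<le> M" if "a \<in> A" for a
    using \<Phi>(2)[of "emb a"] that by (simp add: A M_def)
  \<comment> \<open>A gauge must be defined on the whole line, while \<open>\<delta>\<close> is
    known to be positive only on \<open>[0,1]\<close>. The default radius 1 is harmless because all
    tags lie in \<open>[0,1]\<close>.\<close>
  define \<gamma> where "\<gamma> t = ball t (if t \<in> {0..1} then \<delta> t else 1)" for t
  show thesis
  proof
    show "gauge \<gamma>"
      using \<delta> by (auto simp: gauge_def \<gamma>_def)
    fix p
    assume p: "p tagged_division_of {0..1}" "\<gamma> fine p"
    have tag: "t \<in> {0..1}" if "(t, I) \<in> p" for t I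
      using tagged_division_ofD(2,3)[OF p(1) that] by blast
    have "(\<lambda>t. {t - \<delta> t <..< t + \<delta> t}) fine p"
    proof (rule fineI)
      fix t I
      assume "(t, I) \<in> p"
      then show "I \<subseteq> {t - \<delta> t <..< t + \<delta> t}"
        using fineD[OF p(2)] tag unfolding \<gamma>_def ball_eq_greaterThanLessThan by metis
    qed
    note less = close[OF p(1) this]
    let ?C = "\<Sum>(t, I)\<in>p. measure lborel I * \<bar>f t\<bar>"
    let ?sum = "\<lambda>u. \<Sum>(t, I)\<in>p. measure lborel I * (u (t, I) * f t)"
    have fin: "finite p"
      using p(1) by auto
    \<comment> \<open>This supplies the a priori bound \<open>C\<close> of
      \<open>hausdorff_dist_less_imp_bound\<close>; it may depend on \<open>p\<close>, whereas the
      resulting bound \<open>M + 1\<close> does not.\<close>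
    have "\<bar>b\<bar> \<le> ?C" if "b \<in> {?sum u | u. \<forall>x\<in>p. u x \<in> {0..1}}" for b
    proof -
      obtain u where u: "\<And>x. x \<in> p \<Longrightarrow> 0 \<le> u x \<and> u x \<le> 1" and b: "b = ?sum u"
        using \<open>b \<in> _\<close> by auto
      show ?thesis
        unfolding b using u
        by (intro order_trans[OF sum_abs] sum_mono)
           (fastforce simp: abs_mult intro!: mult_left_mono mult_left_le_one_le)
    qed
    then have bound: "\<bar>?sum u\<bar> < M + 1" if "\<forall>x\<in>p. u x \<in> {0..1}" for u
      using less[unfolded A minkowski_sum_convex_hull_emb[OF fin]] \<open>A \<noteq> {}\<close> M that
      by (intro hausdorff_dist_less_imp_bound) blast+
    \<comment> \<open>The two 0/1 weights select the nonnegative and the negative values of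
      \<open>f\<close>; the difference of the two sums is the sum of absolute values.\<close>
    have "?C = ?sum (\<lambda>(t, I). if 0 \<le> f t then 1 else 0) - ?sum (\<lambda>(t, I). if 0 \<le> f t then 0 else 1)"
      unfolding sum_subtractf[symmetric] by (intro sum.cong) auto
    also have "\<dots> \<le> (M + 1) + (M + 1)"
      using bound[of "\<lambda>(t, I). if 0 \<le> f t then 1 else 0"]
        bound[of "\<lambda>(t, I). if 0 \<le> f t then 0 else 1"]
      by (fastforce split: prod.split)
    finally show "?C \<le> (M + 1) + (M + 1)" .
  qed
qed

theorem mainTheorem3:
  shows "\<exists>(X :: (real \<Rightarrow>\<^sub>0 real) set) (nrm :: (real \<Rightarrow>\<^sub>0 real) \<Rightarrow> real) (g :: real \<Rightarrow> (real \<Rightarrow>\<^sub>0 real)).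
    banach_space_on X nrm \<and>
    g \<in> {0..1} \<rightarrow> X \<and>
    banach_space_on.henstock_integrable X nrm g \<and>
    (\<lambda>t. convex hull {0, g t}) \<in> {0..1} \<rightarrow> banach_space_on.ck X nrm \<and>
    \<not> banach_space_on.henstock_integrable_multi X nrm (\<lambda>t. convex hull {0, g t})"
proof (intro exI conjI)
  show "banach_space_on (range emb) nrm0" ..
  show "(\<lambda>t. emb (osc_deriv t)) \<in> {0..1} \<rightarrow> range emb"
    by simp
  show "line.henstock_integrable (\<lambda>t. emb (osc_deriv t))"
    using has_integral_osc_deriv[of 0 1] by (intro henstock_integrable_emb) auto
  show "(\<lambda>t. convex hull {0, emb (osc_deriv t)}) \<in> {0..1} \<rightarrow> line.ck"
    by (simp add: convex_hull_emb_in_ck)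
  show "\<not> line.henstock_integrable_multi (\<lambda>t. convex hull {0, emb (osc_deriv t)})"
  proof
    assume "line.henstock_integrable_multi (\<lambda>t. convex hull {0, emb (osc_deriv t)})"
    then obtain \<gamma> B where "gauge \<gamma>" and B: "\<And>p. p tagged_division_of {0..1} \<Longrightarrow> \<gamma> fine p \<Longrightarrow>
        (\<Sum>(t, I)\<in>p. measure lborel I * \<bar>osc_deriv t\<bar>) \<le> B"
      using henstock_integrable_multi_imp_bounded by metis
    then show False
      using abs_riemann_sum_osc_deriv_unbounded by (metis not_le)
  qed
qed

end
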